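(* Let $p$ be an odd prime and $n\geq 1$ an integer with $p>2n$, and let $G$ be an extraspecial group of order $p^{2n+1}$. Then $\mathrm{Aut}(G)$ contains no element of order $p^2$; that is, every element of $\mathrm{Aut}(G)$ of $p$-power order has order $1$ or $p$. In particular, if $p\geq 5$, no extraspecial group of order $p^5$ has an automorphism of order $p^2$.
   Context: A $p$-group $G$ is extraspecial if $Z(G)=G'=\Phi(G)$ has order $p$. *)

theory Defs
  imports "HOL-Algebra.Algebra"
begin

definition group_center :: "('a, 'b) monoid_scheme \<Rightarrow> 'a set" where
  "group_center G = {z \<in> carrier G. \<forall>g \<in> carrier G. z \<otimes>\<^bsub>G\<^esub> g = g \<otimes>\<^bsub>G\<^esub> z}"

text \<open>Maximal subgroups and the Frattini subgroup (intersection of all maximal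
  subgroups; equal to G if there are none).\<close>
definition maximal_subgroup :: "'a set \<Rightarrow> ('a, 'b) monoid_scheme \<Rightarrow> bool" where
  "maximal_subgroup H G \<longleftrightarrow> subgroup H G \<and> H \<noteq> carrier G \<and>
     (\<forall>K. subgroup K G \<and> H \<subseteq> K \<longrightarrow> K = H \<or> K = carrier G)"

definition frattini :: "('a, 'b) monoid_scheme \<Rightarrow> 'a set" where
  "frattini G = carrier G \<inter> \<Inter> {H. maximal_subgroup H G}"

definition extraspecial :: "nat \<Rightarrow> ('a, 'b) monoid_scheme \<Rightarrow> bool" where
  "extraspecial p G \<longleftrightarrow> group G \<and> finite (carrier G) \<and> Factorial_Ring.prime p \<and>
     (\<exists>k. order G = p ^ k) \<and>
     group_center G = derived G (carrier G) \<and>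
     derived G (carrier G) = frattini G \<and>
     card (group_center G) = p"

end

theory Submission
  imports Defs
begin

text \<open>
  Baer's trick: with \<open>p = 2 h + 1\<close>, the operation \<open>x y [x, y]\<^sup>h\<close> turns \<open>G\<close> into an
  abelian group \<open>A\<close> of the same order, with the same powers, on which every automorphism \<open>f\<close>
  of \<open>G\<close> still acts. Write \<open>f = 1 + N\<close> in the endomorphism ring of \<open>A\<close>. If \<open>f\<close> has
  \<open>p\<close>-power order, then it fixes the centre, which has order \<open>p\<close>; since \<open>p\<close>-th powers are
  central, \<open>p N = 0\<close>, so the binomial theorem gives \<open>f\<^sup>q = 1 + N\<^sup>q\<close> for every power
  \<open>q\<close> of \<open>p\<close>. Hence \<open>N\<close> is nilpotent, the images of its iterates shrink by a factor of at least
  \<open>p\<close> until they vanish, and \<open>N\<^sup>p = 0\<close> because the order of \<open>A\<close> is \<open>p\<close> to the power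
  \<open>2 n + 1 \<le> p\<close>. Thus \<open>f\<close> to the power \<open>p\<close> is the identity.
\<close>

section \<open>Iterates of homomorphisms and divisors of prime powers\<close>

lemma funpow_in_hom: "f \<in> hom G G \<Longrightarrow> f ^^ m \<in> hom G G"
  by (induction m) (auto simp: hom_def Pi_iff)

text \<open>Divisors of a prime power are powers of the prime, so a proper one lacks at least one
  factor \<open>p\<close>. This measures each strict drop in a chain of subgroups.\<close>

lemma dvd_prime_power_less:
  fixes p a m :: nat
  assumes "Factorial_Ring.prime p" "a dvd b" "a \<noteq> b" "b dvd p ^ Suc m"
  shows "a dvd p ^ m"
proof -
  obtain i where i: "b = p ^ i" "i \<le> Suc m"
    using assms(1,4) divides_primepow_nat by blast
  obtain j where j: "a = p ^ j" "j \<le> i"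
    using assms(1,2) i(1) divides_primepow_nat by blast
  with i assms(3) have "j \<noteq> i" by auto
  with i j have "j \<le> m" by simp
  then show ?thesis using j by (simp add: le_imp_power_dvd)
qed

section \<open>Unipotent endomorphisms of an abelian group\<close>

context comm_group
begin

lemma hom_finprod:
  fixes g :: "nat \<Rightarrow> 'a"
  assumes f: "f \<in> hom G G" and g: "g \<in> {..m} \<rightarrow> carrier G"
  shows "f (finprod G g {..m}) = finprod G (\<lambda>i. f (g i)) {..m}"
  using g
proof (induction m)
  case 0
  then show ?case using f by (simp add: hom_def Pi_iff)
next
  case (Suc m)
  have 1: "(\<lambda>i. f (g i)) \<in> {..Suc m} \<rightarrow> carrier G" "g \<in> {..m} \<rightarrow> carrier G"
    using f Suc.prems by (auto simp: hom_def Pi_iff)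
  then have "finprod G g {..m} \<in> carrier G" by (intro finprod_closed)
  with 1 Suc f show ?case by (simp add: hom_mult Pi_iff)
qed

text \<open>The binomial theorem for \<open>f = 1 + N\<close> in the endomorphism ring, where sums
  are products of values.\<close>

lemma funpow_unipotent_binomial:
  assumes N: "N \<in> hom G G" and f: "\<And>x. x \<in> carrier G \<Longrightarrow> f x = x \<otimes> N x"
    and x: "x \<in> carrier G"
  shows "(f ^^ m) x = (\<Otimes>i\<in>{..m}. (N ^^ i) x [^] (m choose i))"
proof (induction m)
  case 0
  then show ?case using x by simp
next
  case (Suc m)
  have N_closed: "(N ^^ i) x \<in> carrier G" for i
    using funpow_in_hom[OF N, of i] x by (auto simp: hom_def)
  have NN: "N ((N ^^ i) x) \<in> carrier G" for i
    using N_closed[of "Suc i"] by simp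
  let ?P = "\<lambda>m k. \<Otimes>i\<in>{..k}. (N ^^ i) x [^] (m choose i)"
  let ?Q = "\<lambda>k. \<Otimes>i\<in>{..m}. (N ^^ Suc i) x [^] (m choose k i)"
  \<comment> \<open>The added factor has exponent \<open>m choose Suc m\<close>, which is 0; with
    it, splitting off the factor at 0 leaves the index range \<open>{..m}\<close> again.\<close>
  have "?P m (Suc m) = ?P m m"
    using N_closed NN by (subst finprod_Suc) (auto simp: binomial_eq_0)
  moreover have "?P m (Suc m) = ?Q Suc \<otimes> x"
    using N_closed x NN by (subst finprod_Suc2) auto
  ultimately have P: "?P m m = ?Q Suc \<otimes> x" by simp
  have "N (?P m m) = (\<Otimes>i\<in>{..m}. N ((N ^^ i) x [^] (m choose i)))"
    using N_closed by (intro hom_finprod[OF N]) auto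
  also have "\<dots> = ?Q (\<lambda>i. i)"
    using N_closed NN N by (intro finprod_cong) (auto simp: hom_nat_pow is_group)
  finally have NP: "N (?P m m) = ?Q (\<lambda>i. i)" .
  have "(f ^^ Suc m) x = ?P m m \<otimes> N (?P m m)"
    using Suc f N_closed by auto
  also have "\<dots> = ?Q Suc \<otimes> x \<otimes> ?Q (\<lambda>i. i)" using P NP by simp
  also have "\<dots> = ?Q Suc \<otimes> ?Q (\<lambda>i. i) \<otimes> x"
    using NN x by (simp add: m_ac)
  \<comment> \<open>Pascal's rule, factor by factor.\<close>
  also have "?Q Suc \<otimes> ?Q (\<lambda>i. i) = (\<Otimes>i\<in>{..m}. (N ^^ Suc i) x [^] (Suc m choose Suc i))"
    using NN by (subst finprod_multf[symmetric]) (auto intro!: finprod_cong simp: nat_pow_mult add.commute)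
  also have "\<dots> \<otimes> x = ?P (Suc m) (Suc m)"
    using N_closed x NN by (subst finprod_Suc2) auto
  finally show ?case .
qed

text \<open>For 0 < i < p, \<open>p choose i\<close> is a multiple of \<open>p\<close>, and the base
  of the factor lies in the image of \<open>N\<close>, which has exponent \<open>p\<close>. Only the
  factors at 0 and \<open>p\<close> survive.\<close>

lemma funpow_unipotent_prime:
  assumes N: "N \<in> hom G G" and f: "\<And>x. x \<in> carrier G \<Longrightarrow> f x = x \<otimes> N x"
    and p: "Factorial_Ring.prime p" and Np: "\<And>x. x \<in> carrier G \<Longrightarrow> N x [^] (p::nat) = \<one>"
    and x: "x \<in> carrier G"
  shows "(f ^^ p) x = x \<otimes> (N ^^ p) x"
proof -
  \<comment> \<open>Two successors, because removing the factors at both ends leaves the shifted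
    range \<open>{..m}\<close>.\<close>
  obtain m where m: "p = Suc (Suc m)" 
    using prime_ge_2_nat[OF p] by (metis add_2_eq_Suc le_Suc_ex)
  have N_closed: "(N ^^ i) x \<in> carrier G" for i
    using funpow_in_hom[OF N, of i] x by (auto simp: hom_def)
  have NN: "N ((N ^^ i) x) \<in> carrier G" for i
    using N_closed[of "Suc i"] by simp
  have "N ((N ^^ i) x) [^] (p choose Suc i) = \<one>" if "i \<le> m" for i
  proof -
    have "p dvd (p choose Suc i)"
      using that m p by (intro dvd_choose_prime) auto
    then obtain q where "p choose Suc i = p * q" by blast
    then show ?thesis
      using Np[OF N_closed[of i]] NN by (simp flip: nat_pow_pow)
  qed
  then have "(\<Otimes>i\<in>{..m}. (N ^^ Suc i) x [^] (p choose Suc i)) = \<one>"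
    by (intro finprod_one_eqI) auto
  moreover have "(f ^^ p) x = (\<Otimes>i\<in>{..Suc (Suc m)}. (N ^^ i) x [^] (p choose i))"
    using funpow_unipotent_binomial[where f = f, of N x p] N f x m by simp
  moreover have "\<dots> = (N ^^ p) x \<otimes> (\<Otimes>i\<in>{..Suc m}. (N ^^ i) x [^] (p choose i))"
    using N_closed by (subst finprod_Suc) (simp_all add: m del: funpow.simps)
  moreover have "(\<Otimes>i\<in>{..Suc m}. (N ^^ i) x [^] (p choose i)) =
      (\<Otimes>i\<in>{..m}. (N ^^ Suc i) x [^] (p choose Suc i)) \<otimes> x"
    using N_closed NN x by (subst finprod_Suc2) auto
  ultimately show ?thesis using x N_closed by (simp add: m_comm)
qed

text \<open>The prime case is iterated: \<open>f ^^ (p ^ k)\<close> is again unipotent, with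
  \<open>N ^^ (p ^ k)\<close> in place of \<open>N\<close>.\<close>

lemma funpow_unipotent_prime_power:
  assumes N: "N \<in> hom G G" and f: "\<And>x. x \<in> carrier G \<Longrightarrow> f x = x \<otimes> N x"
    and p: "Factorial_Ring.prime p" and Np: "\<And>x. x \<in> carrier G \<Longrightarrow> N x [^] (p::nat) = \<one>"
    and x: "x \<in> carrier G"
  shows "(f ^^ (p ^ k)) x = x \<otimes> (N ^^ (p ^ k)) x"
  using x
proof (induction k arbitrary: x)
  case 0
  then show ?case using f by simp
next
  case (Suc k)
  have "(N ^^ (p ^ k)) x [^] p = \<one>" if "x \<in> carrier G" for x
  proof -
    \<comment> \<open>A positive exponent puts the value into the image of \<open>N\<close>, where
      \<open>Np\<close> applies.\<close>
    have "p ^ k > 0" using prime_gt_0_nat[OF p] by simp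
    then obtain q where q: "p ^ k = Suc q" by (metis Suc_pred')
    have "(N ^^ q) x \<in> carrier G" using funpow_in_hom[OF N, of q] that by (auto simp: hom_def)
    then show ?thesis using q Np by simp
  qed
  then have "((f ^^ p ^ k) ^^ p) x = x \<otimes> ((N ^^ p ^ k) ^^ p) x"
    using Suc by (intro funpow_unipotent_prime[OF funpow_in_hom[OF N] _ p])
  then show ?case by (simp add: funpow_mult mult.commute)
qed

text \<open>The images of the iterates form a descending chain of subgroups. Each strict drop costs
  a factor \<open>p\<close>, and by nilpotency the chain can become stationary only at the trivial
  group, so the crude bound \<open>K\<close> improves to \<open>m\<close>.\<close>

lemma nilpotent_funpow_eq_one:
  assumes N: "N \<in> hom G G" and nil: "\<And>x. x \<in> carrier G \<Longrightarrow> (N ^^ K) x = \<one>"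
    and p: "Factorial_Ring.prime p" and ord: "order G = p ^ m" and x: "x \<in> carrier G"
  shows "(N ^^ m) x = \<one>"
proof -
  define B where "B j = (N ^^ j) ` carrier G" for j
  have sub: "subgroup (B j) G" for j
    unfolding B_def using funpow_in_hom[OF N, of j]
    by (intro group_hom.img_is_subgroup) (simp add: group_hom_def group_hom_axioms_def is_group)
  have N_closed: "N x \<in> carrier G" if "x \<in> carrier G" for x
    using N that by (auto simp: hom_def)
  have B_Suc: "B (Suc j) = N ` B j" for j
    by (auto simp: B_def image_image)
  have decr: "B (Suc j) \<subseteq> B j" for j
    using N_closed by (auto simp: B_def funpow_swap1)
  have fin: "finite (carrier G)"
    using ord prime_gt_0_nat[OF p] by (intro order_gt_0_iff_finite[THEN iffD1]) simp
  \<comment> \<open>For \<open>j \<ge> m\<close> truncated subtraction makes the exponent 0: then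
    \<open>B j\<close> is trivial and no further strict drop can occur.\<close>
  have "card (B j) dvd p ^ (m - j)" for j
  proof (induction j)
    case 0
    then show ?case using ord by (simp add: B_def order_def)
  next
    case (Suc j)
    show ?case
    proof (cases "B (Suc j) = B j")
      case True
      \<comment> \<open>A chain that stops once is constant from there on, hence equals a later
        image that factors through the trivial image of \<open>N ^^ K\<close>.\<close>
      have "B (j + i) = B j" for i
        using True by (induction i) (auto simp: B_Suc)
      then have "B j = B (j + K)" by simp
      also have "\<dots> = (N ^^ j) ` (N ^^ K) ` carrier G"
        by (simp add: B_def funpow_add image_comp)
      also have "(N ^^ K) ` carrier G = {\<one>}" using nil by (auto simp: image_iff)
      also have "(N ^^ j) ` {\<one>} = {\<one>}"
        using hom_one[OF funpow_in_hom[OF N]] is_group by simp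
      finally show ?thesis using True by simp
    next
      case False
      interpret Bj: group "G\<lparr>carrier := B j\<rparr>"
        using sub subgroup.subgroup_is_group is_group by blast
      have "subgroup (B (Suc j)) (G\<lparr>carrier := B j\<rparr>)"
        using sub decr by (intro subgroup_incl)
      from Bj.lagrange[OF this, symmetric] have dvd: "card (B (Suc j)) dvd card (B j)"
        by (simp add: order_def)
      have finB: "finite (B j)" using fin by (simp add: B_def)
      have ne: "card (B (Suc j)) \<noteq> card (B j)"
        using False decr finB card_subset_eq by blast
      show ?thesis
      proof (cases "m - j")
        case 0
        with Suc dvd ne show ?thesis by simp
      next
        case (Suc l)
        then have "m - Suc j = l" by simp
        with dvd_prime_power_less[OF p dvd ne] Suc.IH Suc show ?thesis by simp
      qed
    qed
  qed
  from this[of m] have "card (B m) = 1" by simp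
  moreover have "\<one> \<in> B m" using sub subgroup.one_closed by blast
  ultimately have "B m = {\<one>}" by (metis card_1_singletonE singletonD)
  then show ?thesis using x by (auto simp: B_def)
qed

text \<open>This map is \<open>f - 1\<close> in the endomorphism ring; commutativity makes it a
  homomorphism.\<close>

lemma unipotent_part_hom:
  assumes "f \<in> hom G G"
  shows "(\<lambda>x. inv x \<otimes> f x) \<in> hom G G"
proof (rule homI)
  have f_closed: "f x \<in> carrier G" if "x \<in> carrier G" for x
    using assms that by (auto simp: hom_def)
  then show "inv x \<otimes> f x \<in> carrier G" if "x \<in> carrier G" for x
    using that by simp
  show "inv (x \<otimes> y) \<otimes> f (x \<otimes> y) = (inv x \<otimes> f x) \<otimes> (inv y \<otimes> f y)"
    if "x \<in> carrier G" "y \<in> carrier G" for x y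
    using that f_closed by (simp add: hom_mult[OF assms] inv_mult m_ac)
qed

text \<open>Comparing \<open>f ^^ (p ^ k) = 1\<close> with the unipotent formula gives
  \<open>N ^^ (p ^ k) = 0\<close>. The first conclusion will serve for the centre, the second for
  Baer's group.\<close>

lemma unipotent_part_nilpotent:
  assumes f: "f \<in> hom G G" and p: "Factorial_Ring.prime p" and ord: "order G = p ^ m"
    and fk: "\<And>x. x \<in> carrier G \<Longrightarrow> (f ^^ (p ^ k)) x = x"
    and fp: "\<And>x. x \<in> carrier G \<Longrightarrow> f (x [^] p) = x [^] p"
    and x: "x \<in> carrier G"
  shows "((\<lambda>x. inv x \<otimes> f x) ^^ m) x = \<one>" and "m \<le> p \<Longrightarrow> (f ^^ p) x = x"
proof -
  define N where "N = (\<lambda>x. inv x \<otimes> f x)"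
  have N: "N \<in> hom G G" unfolding N_def by (rule unipotent_part_hom[OF f])
  have f_closed: "f x \<in> carrier G" if "x \<in> carrier G" for x
    using f that by (auto simp: hom_def)
  have fN: "f x = x \<otimes> N x" if "x \<in> carrier G" for x
    using that f_closed by (simp add: N_def flip: m_assoc)
  \<comment> \<open>Fixing \<open>p\<close>-th powers amounts to \<open>p N = 0\<close>.\<close>
  have Np: "N x [^] p = \<one>" if "x \<in> carrier G" for x
  proof -
    have "f x [^] p = x [^] p"
      using fp[OF that] hom_nat_pow[OF f that is_group is_group, of p] by simp
    then show ?thesis
      using that f_closed[OF that] by (simp add: N_def nat_pow_distrib nat_pow_inv)
  qed
  have "(N ^^ (p ^ k)) x = \<one>" if x: "x \<in> carrier G" for x
  proof -
    have "x \<otimes> (N ^^ (p ^ k)) x = x"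
      using funpow_unipotent_prime_power[OF N fN p Np x] fk[OF x] by simp
    moreover have "(N ^^ (p ^ k)) x \<in> carrier G"
      using funpow_in_hom[OF N, of "p ^ k"] x by (auto simp: hom_def)
    ultimately show ?thesis using x by simp
  qed
  then have nil: "(N ^^ m) x = \<one>"
    using x by (intro nilpotent_funpow_eq_one[OF N _ p ord])
  then show "((\<lambda>x. inv x \<otimes> f x) ^^ m) x = \<one>" by (simp add: N_def)
  assume "m \<le> p"
  then have "(N ^^ p) x = (N ^^ (p - m)) ((N ^^ m) x)"
    by (metis comp_apply funpow_add le_add_diff_inverse2)
  then have "(N ^^ p) x = \<one>"
    using nil hom_one[OF funpow_in_hom[OF N]] is_group by simp
  then show "(f ^^ p) x = x"
    using funpow_unipotent_prime[OF N fN p Np x] x by simp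
qed

end

section \<open>The centre and central commutators\<close>

lemma (in group) subgroup_center: "subgroup (group_center G) G"
proof (rule subgroupI)
  show "group_center G \<subseteq> carrier G" "group_center G \<noteq> {}"
    by (auto simp: group_center_def)
next
  fix a assume a: "a \<in> group_center G"
  then have a': "a \<in> carrier G" by (simp add: group_center_def)
  have "inv a \<otimes> g = g \<otimes> inv a" if g: "g \<in> carrier G" for g
  proof -
    have "a \<otimes> inv g = inv g \<otimes> a" using a g by (simp add: group_center_def)
    then have "inv (a \<otimes> inv g) = inv (inv g \<otimes> a)" by simp
    then show ?thesis using a' g by (simp add: inv_mult_group)
  qed
  then show "inv a \<in> group_center G" using a' by (simp add: group_center_def)
next
  fix a b assume ab: "a \<in> group_center G" "b \<in> group_center G"
  then have ab': "a \<in> carrier G" "b \<in> carrier G" by (simp_all add: group_center_def)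
  have "a \<otimes> b \<otimes> g = g \<otimes> (a \<otimes> b)" if g: "g \<in> carrier G" for g
  proof -
    have "b \<otimes> g = g \<otimes> b" "a \<otimes> g = g \<otimes> a" using ab g by (simp_all add: group_center_def)
    then show ?thesis using ab' g by (metis m_assoc)
  qed
  then show "a \<otimes> b \<in> group_center G" using ab' by (simp add: group_center_def)
qed

text \<open>The convention of the generators of \<open>derived\<close>, so that commutators are
  literally among them.\<close>

definition commutator :: "('a, 'b) monoid_scheme \<Rightarrow> 'a \<Rightarrow> 'a \<Rightarrow> 'a" where
  "commutator G x y = x \<otimes>\<^bsub>G\<^esub> y \<otimes>\<^bsub>G\<^esub> inv\<^bsub>G\<^esub> x \<otimes>\<^bsub>G\<^esub> inv\<^bsub>G\<^esub> y"

text \<open>If commutators are central of exponent \<open>2 h + 1\<close>, then \<open>h\<close> plays the role of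
  \<open>-1/2\<close>, so that the correction factor makes the product symmetric.\<close>
definition baer_mult :: "('a, 'b) monoid_scheme \<Rightarrow> nat \<Rightarrow> 'a \<Rightarrow> 'a \<Rightarrow> 'a" where
  "baer_mult G h x y = x \<otimes>\<^bsub>G\<^esub> y \<otimes>\<^bsub>G\<^esub> commutator G x y [^]\<^bsub>G\<^esub> h"

definition baer_group :: "('a, 'b) monoid_scheme \<Rightarrow> nat \<Rightarrow> ('a, 'b) monoid_scheme" where
  "baer_group G h = G\<lparr>mult := baer_mult G h\<rparr>"

lemma baer_group_simps [simp]:
  "carrier (baer_group G h) = carrier G"
  "one (baer_group G h) = one G"
  "monoid.mult (baer_group G h) = baer_mult G h"
  by (simp_all add: baer_group_def)

text \<open>What Baer's trick needs of an extraspecial group: class at most 2 and commutators of odd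
  exponent.\<close>

locale central_commutators = group +
  fixes h :: nat
  assumes commutator_central:
    "x \<in> carrier G \<Longrightarrow> y \<in> carrier G \<Longrightarrow> commutator G x y \<in> group_center G"
    and commutator_exponent:
    "x \<in> carrier G \<Longrightarrow> y \<in> carrier G \<Longrightarrow> commutator G x y [^] Suc (2 * h) = \<one>"
begin

abbreviation comm where "comm x y \<equiv> commutator G x y"

lemma center_closed: "z \<in> group_center G \<Longrightarrow> z \<in> carrier G"
  and center_commute: "z \<in> group_center G \<Longrightarrow> g \<in> carrier G \<Longrightarrow> z \<otimes> g = g \<otimes> z"
  by (auto simp: group_center_def)

lemma center_left_commute:
  "z \<in> group_center G \<Longrightarrow> g \<in> carrier G \<Longrightarrow> y \<in> carrier G \<Longrightarrow> g \<otimes> (z \<otimes> y) = z \<otimes> (g \<otimes> y)"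
  using m_assoc[of g z y] m_assoc[of z g y] center_commute[of z g] center_closed[of z] by simp

lemma center_nat_pow: "z \<in> group_center G \<Longrightarrow> z [^] (n::nat) \<in> group_center G"
  using subgroup_center by (induction n) (auto simp: subgroup.one_closed subgroup.m_closed)

lemma center_mult_pow:
  "z \<in> group_center G \<Longrightarrow> g \<in> carrier G \<Longrightarrow> (z \<otimes> g) [^] (n::nat) = z [^] n \<otimes> g [^] n"
  using pow_mult_distrib[of z g n] center_commute[of z g] center_closed[of z] by blast

lemma commutator_closed [simp]:
  "x \<in> carrier G \<Longrightarrow> y \<in> carrier G \<Longrightarrow> comm x y \<in> carrier G"
  by (simp add: commutator_def)

lemma commutator_swap:
  assumes "x \<in> carrier G" "y \<in> carrier G"
  shows "x \<otimes> y = comm x y \<otimes> (y \<otimes> x)"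
proof -
  have "inv y \<otimes> (y \<otimes> x) = x" using assms by (simp flip: m_assoc)
  then show ?thesis using assms by (simp add: commutator_def m_assoc)
qed

text \<open>By cancellation the swap equation determines the commutator, so commutators can be
  computed without expanding inverses.\<close>

lemma commutator_eqI:
  assumes "x \<in> carrier G" "y \<in> carrier G" "z \<in> carrier G" "x \<otimes> y = z \<otimes> (y \<otimes> x)"
  shows "comm x y = z"
proof -
  have "comm x y \<otimes> (y \<otimes> x) = z \<otimes> (y \<otimes> x)"
    by (rule trans[OF commutator_swap[OF assms(1,2), symmetric] assms(4)])
  then show ?thesis using assms(1-3) r_cancel[of "y \<otimes> x"] by simp
qed

text \<open>Moving \<open>y\<close> to the left past \<open>x'\<close> and then \<open>x\<close>
  produces one commutator each time; being central, both collect in front.\<close>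

lemma commutator_mult_left:
  assumes "x \<in> carrier G" "x' \<in> carrier G" "y \<in> carrier G"
  shows "comm (x \<otimes> x') y = comm x y \<otimes> comm x' y"
proof (rule commutator_eqI)
  have "x \<otimes> x' \<otimes> y = x \<otimes> (comm x' y \<otimes> (y \<otimes> x'))"
    using assms commutator_swap[of x' y] by (simp add: m_assoc)
  also have "\<dots> = comm x' y \<otimes> (x \<otimes> y \<otimes> x')"
    using assms center_left_commute[of "comm x' y" x "y \<otimes> x'"]
    by (simp add: commutator_central m_assoc)
  also have "\<dots> = comm x' y \<otimes> (comm x y \<otimes> (y \<otimes> (x \<otimes> x')))"
    using assms commutator_swap[of x y] by (simp add: m_assoc)
  also have "\<dots> = comm x y \<otimes> comm x' y \<otimes> (y \<otimes> (x \<otimes> x'))"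
    using assms center_commute[of "comm x' y" "comm x y"]
    by (simp add: commutator_central flip: m_assoc)
  finally show "x \<otimes> x' \<otimes> y = comm x y \<otimes> comm x' y \<otimes> (y \<otimes> (x \<otimes> x'))" .
qed (use assms in auto)

lemma commutator_inv:
  assumes "x \<in> carrier G" "y \<in> carrier G"
  shows "comm y x = inv (comm x y)"
  using assms by (simp add: commutator_def inv_mult_group m_assoc)

lemma commutator_mult_right:
  assumes "x \<in> carrier G" "y \<in> carrier G" "y' \<in> carrier G"
  shows "comm x (y \<otimes> y') = comm x y \<otimes> comm x y'"
proof -
  have "comm x (y \<otimes> y') = inv (comm y x \<otimes> comm y' x)"
    using assms commutator_inv[of "y \<otimes> y'" x] by (simp add: commutator_mult_left)
  also have "\<dots> = comm x y' \<otimes> comm x y"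
    using assms commutator_inv[of y x] commutator_inv[of y' x] by (simp add: inv_mult_group)
  also have "\<dots> = comm x y \<otimes> comm x y'"
    using assms by (intro center_commute commutator_central commutator_closed)
  finally show ?thesis .
qed

lemma commutator_center:
  assumes "x \<in> carrier G" "z \<in> group_center G"
  shows "comm z x = \<one>" "comm x z = \<one>"
  using assms by (auto intro!: commutator_eqI simp: center_closed center_commute)

text \<open>By multiplicativity in the first argument, \<open>[x^n, y] = [x, y]^n\<close>, which is
  trivial for \<open>n = 2 h + 1\<close>.\<close>

lemma pow_central:
  assumes x: "x \<in> carrier G"
  shows "x [^] Suc (2 * h) \<in> group_center G"
proof -
  have comm_pow: "comm (x [^] n) y = comm x y [^] n" if "y \<in> carrier G" for n :: nat and y
  proof (induction n)
    case 0
    show ?case using that by (auto intro: commutator_eqI)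
  qed (use that x in \<open>simp add: commutator_mult_left\<close>)
  have "x [^] Suc (2 * h) \<otimes> y = y \<otimes> x [^] Suc (2 * h)" if y: "y \<in> carrier G" for y
    using commutator_swap[of "x [^] Suc (2 * h)" y] comm_pow[OF y, of "Suc (2 * h)"]
      commutator_exponent[OF x y] x y by (simp del: nat_pow_Suc)
  then show ?thesis using x by (simp add: group_center_def del: nat_pow_Suc)
qed

section \<open>Baer's abelian group\<close>

lemma baer_mult_closed:
  "x \<in> carrier G \<Longrightarrow> y \<in> carrier G \<Longrightarrow> baer_mult G h x y \<in> carrier G"
  by (simp add: baer_mult_def)

lemma baer_mult_center:
  assumes "x \<in> carrier G" "z \<in> group_center G"
  shows "baer_mult G h z x = z \<otimes> x" "baer_mult G h x z = x \<otimes> z"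
  using assms by (simp_all add: baer_mult_def commutator_center center_closed)

text \<open>With \<open>c = [x, y]\<close>, swapping \<open>x\<close> and \<open>y\<close> costs a
  factor \<open>c\<close>, and \<open>c^(h+1) = c^(-h) = [y, x]^h\<close> because
  \<open>c^(2h+1) = 1\<close>.\<close>

lemma baer_mult_commute:
  assumes xy: "x \<in> carrier G" "y \<in> carrier G"
  shows "baer_mult G h x y = baer_mult G h y x"
proof -
  let ?c = "comm x y"
  have c: "?c \<in> carrier G" using xy by simp
  have "?c [^] Suc h \<otimes> ?c [^] h = ?c [^] Suc (2 * h)"
    using c by (simp only: nat_pow_mult) (simp add: mult_2)
  then have "?c [^] Suc h = inv (?c [^] h)"
    using commutator_exponent[OF xy] c by (simp add: inv_equality del: nat_pow_Suc)
  also have "\<dots> = comm y x [^] h"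
    using c xy by (simp add: commutator_inv[of x y] nat_pow_inv)
  finally have pow: "?c [^] Suc h = comm y x [^] h" .
  have "x \<otimes> y \<otimes> ?c [^] h = y \<otimes> x \<otimes> ?c \<otimes> ?c [^] h"
    using xy commutator_swap[OF xy] center_commute[OF commutator_central[OF xy], of "y \<otimes> x"] by simp
  also have "\<dots> = y \<otimes> x \<otimes> ?c [^] Suc h"
    using xy c nat_pow_Suc2[OF c, of h] by (simp add: m_assoc del: nat_pow_Suc)
  finally show ?thesis using pow by (simp add: baer_mult_def)
qed

text \<open>Central factors do not affect commutators, so by bimultiplicativity both sides are
  \<open>x y z\<close> times the \<open>h\<close>-th powers of \<open>[x, y]\<close>,
  \<open>[x, z]\<close> and \<open>[y, z]\<close>.\<close>

lemma baer_mult_assoc: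
  assumes xyz: "x \<in> carrier G" "y \<in> carrier G" "z \<in> carrier G"
  shows "baer_mult G h (baer_mult G h x y) z = baer_mult G h x (baer_mult G h y z)"
proof -
  let ?a = "comm x y" and ?b = "comm y z" and ?c = "comm x z"
  have C: "?a [^] h \<in> group_center G" "?b [^] h \<in> group_center G" "?c [^] h \<in> group_center G"
    "?a \<in> group_center G" "?b \<in> group_center G" "?c \<in> group_center G"
    using xyz commutator_central center_nat_pow by auto
  have "comm (x \<otimes> y \<otimes> ?a [^] h) z = ?c \<otimes> ?b" "comm x (y \<otimes> z \<otimes> ?b [^] h) = ?a \<otimes> ?c"
    using xyz C by (simp_all add: commutator_mult_left commutator_mult_right commutator_center)
  then have "baer_mult G h (baer_mult G h x y) z = x \<otimes> y \<otimes> ?a [^] h \<otimes> z \<otimes> (?c [^] h \<otimes> ?b [^] h)"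
    "baer_mult G h x (baer_mult G h y z) = x \<otimes> (y \<otimes> z \<otimes> ?b [^] h) \<otimes> (?a [^] h \<otimes> ?c [^] h)"
    using xyz C by (simp_all add: baer_mult_def center_mult_pow)
  moreover have "x \<otimes> y \<otimes> a \<otimes> z \<otimes> (c \<otimes> b) = x \<otimes> (y \<otimes> z \<otimes> b) \<otimes> (a \<otimes> c)"
    if abc: "a \<in> group_center G" "b \<in> group_center G" "c \<in> group_center G" for a b c
  proof -
    note [simp] = abc[THEN center_closed]
    have "x \<otimes> y \<otimes> a \<otimes> z \<otimes> (c \<otimes> b) = x \<otimes> y \<otimes> (a \<otimes> z) \<otimes> (c \<otimes> b)"
      using xyz by (simp add: m_assoc)
    also have "a \<otimes> z = z \<otimes> a" using center_commute[OF abc(1)] xyz by blast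
    also have "x \<otimes> y \<otimes> (z \<otimes> a) \<otimes> (c \<otimes> b) = x \<otimes> y \<otimes> z \<otimes> ((a \<otimes> c) \<otimes> b)"
      using xyz by (simp add: m_assoc)
    also have "(a \<otimes> c) \<otimes> b = b \<otimes> (a \<otimes> c)"
      using center_commute[OF abc(2), of "a \<otimes> c"] by simp
    finally show ?thesis using xyz by (simp add: m_assoc)
  qed
  ultimately show ?thesis using C by simp
qed

lemma comm_group_baer_group: "comm_group (baer_group G h)"
proof (rule comm_groupI)
  fix x assume "x \<in> carrier (baer_group G h)"
  then have x: "x \<in> carrier G" by simp
  \<comment> \<open>The correction factor vanishes, so the old inverse still works.\<close>
  have "comm (inv x) x = \<one>" using x by (auto intro!: commutator_eqI)
  then have "baer_mult G h (inv x) x = \<one>" using x by (simp add: baer_mult_def)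
  then show "\<exists>y\<in>carrier (baer_group G h). y \<otimes>\<^bsub>baer_group G h\<^esub> x = \<one>\<^bsub>baer_group G h\<^esub>"
    using x by auto
next
  fix x y assume "x \<in> carrier (baer_group G h)" "y \<in> carrier (baer_group G h)"
  then show "x \<otimes>\<^bsub>baer_group G h\<^esub> y = y \<otimes>\<^bsub>baer_group G h\<^esub> x"
    using baer_mult_commute by simp
qed (use subgroup.one_closed[OF subgroup_center] in
    \<open>simp_all add: baer_mult_closed baer_mult_assoc baer_mult_center\<close>)

text \<open>Powers of \<open>x\<close> commute with \<open>x\<close>, so no correction factor
  arises.\<close>

lemma nat_pow_baer_group:
  assumes x: "x \<in> carrier G"
  shows "x [^]\<^bsub>baer_group G h\<^esub> (n::nat) = x [^] n"
proof (induction n)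
  case 0
  show ?case by (simp add: nat_pow_def)
next
  case (Suc n)
  have "comm (x [^] n) x = \<one>"
    using x by (intro commutator_eqI) (auto simp flip: nat_pow_Suc2)
  then show ?case using Suc x by (simp add: baer_mult_def)
qed

lemma commutator_hom:
  assumes "f \<in> hom G G" "x \<in> carrier G" "y \<in> carrier G"
  shows "f (comm x y) = comm (f x) (f y)"
proof -
  interpret f: group_hom G G f using assms by unfold_locales
  show ?thesis using assms by (simp add: commutator_def)
qed

lemma hom_baer_group:
  assumes f: "f \<in> hom G G"
  shows "f \<in> hom (baer_group G h) (baer_group G h)"
proof (rule homI)
  fix x y assume "x \<in> carrier (baer_group G h)" "y \<in> carrier (baer_group G h)"
  then have xy: "x \<in> carrier G" "y \<in> carrier G" by auto
  interpret f: group_hom G G f using f by unfold_locales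
  show "f (x \<otimes>\<^bsub>baer_group G h\<^esub> y) = f x \<otimes>\<^bsub>baer_group G h\<^esub> f y"
    using xy commutator_hom[OF f xy] by (simp add: baer_mult_def f.hom_nat_pow)
qed (use f in \<open>auto simp: hom_def\<close>)

section \<open>Automorphisms of \<open>p\<close>-power order\<close>

text \<open>The unipotent argument is used twice: on the centre, to see that \<open>f\<close> fixes
  it and hence all \<open>p\<close>-th powers, and then on Baer's group.\<close>

lemma p_power_automorphism_funpow_eq:
  assumes p: "Factorial_Ring.prime p" "p = Suc (2 * h)"
    and ord: "order G = p ^ m" "m \<le> p" and Z: "card (group_center G) = p"
    and f: "f \<in> hom G G" "f ` carrier G = carrier G"
    and fk: "\<And>x. x \<in> carrier G \<Longrightarrow> (f ^^ (p ^ k)) x = x"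
    and x: "x \<in> carrier G"
  shows "(f ^^ p) x = x"
proof -
  let ?C = "G\<lparr>carrier := group_center G\<rparr>"
  have f_center: "f z \<in> group_center G" if z: "z \<in> group_center G" for z
  proof -
    \<comment> \<open>This gives commutation with images under \<open>f\<close> only; surjectivity
      of \<open>f\<close> makes these all of \<open>G\<close>.\<close>
    have "f z \<otimes> f g = f g \<otimes> f z" if "g \<in> carrier G" for g
      using center_commute[OF z that] center_closed[OF z] that f(1) by (metis hom_mult)
    then have "\<forall>g \<in> f ` carrier G. f z \<otimes> g = g \<otimes> f z" by simp
    moreover have "f z \<in> carrier G" using f(1) center_closed[OF z] by (auto simp: hom_def)
    ultimately show ?thesis unfolding f(2) by (simp add: group_center_def)
  qed
  have "group ?C" using subgroup_center is_group subgroup.subgroup_is_group by blast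
  then interpret C: comm_group ?C
    by (rule group.group_comm_groupI) (simp add: center_commute center_closed)
  have ordC: "order ?C = p ^ 1" using Z by (simp add: order_def)
  have fC: "f \<in> hom ?C ?C"
    using f_center f(1) center_closed by (auto simp: hom_def)
  have f_fix: "f z = z" if z: "z \<in> group_center G" for z
  proof -
    have pow_fix: "f (y [^]\<^bsub>?C\<^esub> p) = y [^]\<^bsub>?C\<^esub> p" if "y \<in> carrier ?C" for y
    proof -
      have "y [^]\<^bsub>?C\<^esub> p = \<one>\<^bsub>?C\<^esub>"
        using C.pow_order_eq_1[OF that] unfolding ordC power_one_right .
      then show ?thesis using hom_one[OF fC C.is_group C.is_group] by simp
    qed
    \<comment> \<open>The centre has order \<open>p ^ 1\<close>, so already the first iterate of
      \<open>f - 1\<close> vanishes there.\<close>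
    have "((\<lambda>x. inv\<^bsub>?C\<^esub> x \<otimes>\<^bsub>?C\<^esub> f x) ^^ 1) z = \<one>\<^bsub>?C\<^esub>"
      using fk center_closed z
      by (intro C.unipotent_part_nilpotent(1)[OF fC p(1) ordC _ pow_fix]) auto
    then have "inv\<^bsub>?C\<^esub> z \<otimes>\<^bsub>?C\<^esub> f z = \<one>\<^bsub>?C\<^esub>"
      unfolding One_nat_def funpow.simps comp_apply id_apply .
    also have "\<dots> = inv\<^bsub>?C\<^esub> z \<otimes>\<^bsub>?C\<^esub> z"
      using z by (intro C.l_inv[symmetric]) simp
    finally show ?thesis
      using z f_center[OF z] C.inv_closed[of z] C.l_cancel[of "inv\<^bsub>?C\<^esub> z" "f z" z] by simp
  qed
  interpret A: comm_group "baer_group G h" by (rule comm_group_baer_group)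
  have "f (y [^]\<^bsub>baer_group G h\<^esub> p) = y [^]\<^bsub>baer_group G h\<^esub> p" if "y \<in> carrier G" for y
    using f_fix[OF pow_central[OF that]] unfolding nat_pow_baer_group[OF that] p(2) .
  moreover have "order (baer_group G h) = p ^ m" using ord(1) by (simp add: order_def)
  ultimately show ?thesis
    using fk x ord(2) by (intro A.unipotent_part_nilpotent(2)[OF hom_baer_group[OF f(1)] p(1)]) auto
qed

end

section \<open>Orders in the automorphism group\<close>

lemma AutoGroup_nat_pow:
  assumes "\<phi> \<in> carrier (AutoGroup G)"
  shows "\<phi> [^]\<^bsub>AutoGroup G\<^esub> (m::nat) = restrict (\<phi> ^^ m) (carrier G)"
proof (induction m)
  case 0
  show ?case by (auto simp: AutoGroup_def BijGroup_def)
next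
  case (Suc m)
  have \<phi>: "\<phi> \<in> Bij (carrier G)" using assms by (simp add: AutoGroup_def auto_def)
  have mult: "g \<otimes>\<^bsub>AutoGroup G\<^esub> f = compose (carrier G) g f"
    if "g \<in> Bij (carrier G)" "f \<in> Bij (carrier G)" for f g
    using that by (simp add: AutoGroup_def BijGroup_def)
  have \<phi>_closed: "\<phi> y \<in> carrier G" if "y \<in> carrier G" for y
    using Bij_imp_funcset \<phi> that by blast
  \<comment> \<open>The product of \<open>BijGroup\<close> is composition only on members of
    \<open>Bij\<close>, so membership of the iterate has to be shown.\<close>
  have "bij_betw (\<phi> ^^ m) (carrier G) (carrier G)"
    using \<phi> by (intro bij_betw_funpow) (simp add: Bij_def)
  then have "restrict (\<phi> ^^ m) (carrier G) \<in> Bij (carrier G)"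
    by (simp add: Bij_def cong: bij_betw_cong)
  then have "\<phi> [^]\<^bsub>AutoGroup G\<^esub> Suc m = compose (carrier G) (restrict (\<phi> ^^ m) (carrier G)) \<phi>"
    using mult[OF _ \<phi>] Suc by (metis nat_pow_Suc)
  also have "\<dots> = restrict (\<phi> ^^ Suc m) (carrier G)"
    using \<phi>_closed by (auto simp: compose_def funpow_swap1)
  finally show ?case .
qed

theorem theorem3p3:
  fixes G :: "('a, 'b) monoid_scheme" and p n :: nat
  assumes "Factorial_Ring.prime p" and "odd p" and "n \<ge> 1" and "p > 2 * n"
    and "extraspecial p G" and "order G = p ^ (2 * n + 1)"
  shows "(\<forall>\<phi> \<in> carrier (AutoGroup G). group.ord (AutoGroup G) \<phi> \<noteq> p ^ 2) \<and>
         (\<forall>\<phi> \<in> carrier (AutoGroup G). \<forall>k::nat.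
            group.ord (AutoGroup G) \<phi> = p ^ k \<longrightarrow> group.ord (AutoGroup G) \<phi> \<in> {1, p})"
proof -
  interpret group G using assms(5) by (simp add: extraspecial_def)
  obtain h where h: "p = Suc (2 * h)" using \<open>odd p\<close> by (auto elim: oddE)
  have Z: "group_center G = derived G (carrier G)" "card (group_center G) = p"
    using assms(5) unfolding extraspecial_def by blast+
  interpret central_commutators G h
  proof
    fix x y assume xy: "x \<in> carrier G" "y \<in> carrier G"
    then show c: "commutator G x y \<in> group_center G"
      unfolding Z(1) derived_def commutator_def by (intro generate.incl) auto
    interpret C: group "G\<lparr>carrier := group_center G\<rparr>"
      using subgroup_center is_group subgroup.subgroup_is_group by blast
    \<comment> \<open>The centre has order \<open>p\<close>, so its elements have
      \<open>p\<close>-th power one.\<close>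
    have "commutator G x y [^]\<^bsub>G\<lparr>carrier := group_center G\<rparr>\<^esub> p = \<one>\<^bsub>G\<^esub>"
      using C.pow_order_eq_1[of "commutator G x y"] c Z(2) by (simp add: order_def)
    then show "commutator G x y [^]\<^bsub>G\<^esub> Suc (2 * h) = \<one>\<^bsub>G\<^esub>"
      using h nat_pow_consistent by metis
  qed
  interpret Aut: group "AutoGroup G" by (rule AutoGroup)
  have main: "Aut.ord \<phi> \<in> {1, p}" if \<phi>: "\<phi> \<in> carrier (AutoGroup G)" and ord: "Aut.ord \<phi> = p ^ k" for \<phi> k
  proof -
    have \<phi>': "\<phi> \<in> hom G G" "\<phi> \<in> Bij (carrier G)"
      using \<phi> by (auto simp: AutoGroup_def auto_def)
    have one: "\<one>\<^bsub>AutoGroup G\<^esub> = (\<lambda>x\<in>carrier G. x)"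
      by (simp add: AutoGroup_def BijGroup_def)
    have "(\<phi> ^^ (p ^ k)) x = x" if "x \<in> carrier G" for x
      using Aut.pow_ord_eq_1[OF \<phi>] ord AutoGroup_nat_pow[OF \<phi>, of "p ^ k"] one that by (metis restrict_apply')
    \<comment> \<open>Here \<open>p > 2 * n\<close> enters, as
      \<open>2 * n + 1 \<le> p\<close>.\<close>
    then have "(\<phi> ^^ p) x = x" if "x \<in> carrier G" for x
      using that assms(4) Z(2) \<phi>'
      by (intro p_power_automorphism_funpow_eq[OF assms(1) h assms(6)])
        (auto simp: Bij_def bij_betw_def)
    then have "\<phi> [^]\<^bsub>AutoGroup G\<^esub> p = \<one>\<^bsub>AutoGroup G\<^esub>"
      unfolding AutoGroup_nat_pow[OF \<phi>] one by (intro restrict_ext)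
    then have "Aut.ord \<phi> dvd p" using Aut.pow_eq_id[OF \<phi>] by blast
    then show ?thesis using assms(1) prime_nat_iff by auto
  qed
  \<comment> \<open>Order \<open>p ^ 2\<close> is thus excluded by \<open>main\<close> with
    \<open>k = 2\<close>.\<close>
  have "p ^ 2 \<notin> {1, p}" using prime_gt_1_nat[OF assms(1)] by (auto simp: power2_eq_square)
  then show ?thesis using main by metis
qed

end
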